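(* Let $X$ be a ccc Hausdorff space and let $\kappa$ be a cardinal such that $\mathrm{pct}(X) \leq \kappa \leq |X|$. Then there is a subspace $Y \subseteq X$ with $|Y|=\kappa$ such that $Y$ (with the subspace topology) is ccc.
   Context: A topological space $(X,\tau)$ is ccc (has the countable chain condition) if for any uncountable $\mathcal{F}\subseteq\tau$ there are distinct $U,V\in\mathcal{F}$ with $U\cap V\neq\emptyset$. For $K\subseteq X$, the character $\chi(K,X)$ is the least cardinality of an outer base of $K$ in $X$, i.e. of a family $\mathcal{B}$ of open sets containing $K$ such that every open set containing $K$ contains a member of $\mathcal{B}$. The pointwise compactness type $\mathrm{pct}(X)$ is the smallest infinite cardinal $\lambda$ for which $X$ can be covered by compact subsets $K$ with $\chi(K,X)\leq\lambda$. *)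

theory Defs
  imports "HOL-Analysis.Analysis"
begin

unbundle cardinal_syntax

definition ccc_space :: "'a topology \<Rightarrow> bool" where
  "ccc_space X \<longleftrightarrow>
     (\<forall>\<F>. (\<forall>U\<in>\<F>. openin X U) \<and> uncountable \<F> \<longrightarrow>
        (\<exists>U\<in>\<F>. \<exists>V\<in>\<F>. U \<noteq> V \<and> U \<inter> V \<noteq> {}))"

definition outer_base :: "'a set \<Rightarrow> 'a topology \<Rightarrow> 'a set set \<Rightarrow> bool" where
  "outer_base K X \<B> \<longleftrightarrow>
     (\<forall>B\<in>\<B>. openin X B \<and> K \<subseteq> B) \<and>
     (\<forall>U. openin X U \<and> K \<subseteq> U \<longrightarrow> (\<exists>B\<in>\<B>. B \<subseteq> U))"

(* Cardinals are minimal well-orders, compared by \<le>o across types. *)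

definition least_outer_base :: "'a set \<Rightarrow> 'a topology \<Rightarrow> 'a set set \<Rightarrow> bool" where
  "least_outer_base K X \<B> \<longleftrightarrow>
     outer_base K X \<B> \<and> (\<forall>\<B>'. outer_base K X \<B>' \<longrightarrow> |\<B>| \<le>o |\<B>'| )"

definition character :: "'a set \<Rightarrow> 'a topology \<Rightarrow> 'a set rel" where
  "character K X = |SOME \<B>. least_outer_base K X \<B>|"

definition covered_by_compacts_of_character_le :: "'a topology \<Rightarrow> 'k rel \<Rightarrow> bool" where
  "covered_by_compacts_of_character_le X \<kappa> \<longleftrightarrow>
     (\<exists>\<C>. (\<forall>K\<in>\<C>. compactin X K \<and> character K X \<le>o \<kappa>) \<and> topspace X \<subseteq> \<Union>\<C>)"

(* The type 'a set + nat has room for a representative of the least such cardinal: every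
   character is bounded by the number of open sets, and the summand nat provides an infinite
   cardinal when 'a is finite. That the value is least among cardinals over all types is
   lemma pct_least below. *)

definition is_pct :: "'a topology \<Rightarrow> ('a set + nat) rel \<Rightarrow> bool" where
  "is_pct X r \<longleftrightarrow>
     Cinfinite r \<and> covered_by_compacts_of_character_le X r \<and>
     (\<forall>r' :: ('a set + nat) rel.
        Cinfinite r' \<and> covered_by_compacts_of_character_le X r' \<longrightarrow> r \<le>o r')"

definition pct :: "'a topology \<Rightarrow> ('a set + nat) rel" where
  "pct X = (SOME r. is_pct X r)"

lemma least_outer_base_exists: "\<exists>\<B>. least_outer_base K X \<B>"
proof -
  let ?R = "card_of ` {\<B>. outer_base K X \<B>}"
  have "outer_base K X {U. openin X U \<and> K \<subseteq> U}"
    by (auto simp: outer_base_def)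
  then have "?R \<noteq> {}" by blast
  moreover have "\<forall>r\<in>?R. Card_order r" by (auto simp: card_of_Card_order)
  ultimately have "\<exists>r\<in>?R. \<forall>r'\<in>?R. r \<le>o r'" by (rule exists_minim_Card_order)
  then show ?thesis by (auto simp: least_outer_base_def)
qed

lemma character_attained:
  obtains \<B> where "outer_base K X \<B>" "character K X = |\<B>|"
  using someI_ex[OF least_outer_base_exists[of K X]]
  by (auto simp: least_outer_base_def character_def)

lemma character_least: "outer_base K X \<B> \<Longrightarrow> character K X \<le>o |\<B>|"
  using someI_ex[OF least_outer_base_exists[of K X]]
  by (auto simp: least_outer_base_def character_def)

lemma covered_by_compacts_mono:
  "covered_by_compacts_of_character_le X r \<Longrightarrow> r \<le>o s \<Longrightarrow> covered_by_compacts_of_character_le X s"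
  unfolding covered_by_compacts_of_character_le_def by (meson ordLeq_transitive)

lemma Cinfinite_type: "Cinfinite |UNIV :: ('a set + nat) set|"
  using card_of_Card_order[of "UNIV :: ('a set + nat) set"]
  by (simp add: cinfinite_def Field_card_of finite_Plus_UNIV_iff)

lemma covered_by_compacts_type:
  "covered_by_compacts_of_character_le (X :: 'a topology) |UNIV :: ('a set + nat) set|"
proof -
  have "character K X \<le>o |UNIV :: ('a set + nat) set|" for K
  proof -
    obtain \<B> where "character K X = |\<B>|" by (rule character_attained)
    moreover have "|\<B>| \<le>o |UNIV :: ('a set + nat) set|"
      by (rule card_of_ordLeqI[where f = Inl]) auto
    ultimately show ?thesis by simp
  qed
  then show ?thesis
    unfolding covered_by_compacts_of_character_le_def
    by (intro exI[of _ "(\<lambda>x. {x}) ` topspace X"]) auto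
qed

lemma is_pct_pct: "is_pct X (pct X)"
proof -
  let ?R = "{r :: ('a set + nat) rel. Cinfinite r \<and> covered_by_compacts_of_character_le X r}"
  have "?R \<noteq> {}" using Cinfinite_type covered_by_compacts_type by blast
  moreover have "\<forall>r\<in>?R. Card_order r" by auto
  ultimately have "\<exists>r\<in>?R. \<forall>r'\<in>?R. r \<le>o r'" by (rule exists_minim_Card_order)
  then have "\<exists>r. is_pct X r" by (auto simp: is_pct_def)
  then show ?thesis unfolding pct_def by (rule someI_ex)
qed

lemma pct_Cinfinite: "Cinfinite (pct X)"
  and pct_covered: "covered_by_compacts_of_character_le X (pct X)"
  using is_pct_pct by (auto simp: is_pct_def)

lemma pct_least:
  fixes X :: "'a topology" and \<kappa> :: "'k rel"
  assumes inf: "Cinfinite \<kappa>" and cov: "covered_by_compacts_of_character_le X \<kappa>"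
  shows "pct X \<le>o \<kappa>"
proof -
  let ?M = "|UNIV :: ('a set + nat) set|"
  have co: "Card_order \<kappa>" using inf by simp
  have "?M \<le>o \<kappa> \<or> \<kappa> \<le>o ?M"
    using co card_of_Well_order by (intro ordLeq_total) (auto simp: card_order_on_def)
  then show ?thesis
  proof
    assume "?M \<le>o \<kappa>"
    moreover have "pct X \<le>o ?M"
      using is_pct_pct[of X] Cinfinite_type covered_by_compacts_type
      unfolding is_pct_def by blast
    ultimately show ?thesis using ordLeq_transitive by blast
  next
    assume "\<kappa> \<le>o ?M"
    then have "|Field \<kappa>| \<le>o ?M"
      using card_of_Field_ordIso[OF co] ordIso_ordLeq_trans by blast
    then obtain A :: "('a set + nat) set" where "|Field \<kappa>| =o |A|"
      using internalize_card_of_ordLeq[of "Field \<kappa>" ?M] by blast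
    then have eq: "\<kappa> =o |A|"
      using card_of_Field_ordIso[OF co] ordIso_symmetric ordIso_transitive by blast
    have "Cinfinite |A|" using Cinfinite_cong[OF eq inf] .
    moreover have "covered_by_compacts_of_character_le X |A|"
      using covered_by_compacts_mono[OF cov] eq ordIso_iff_ordLeq by blast
    ultimately have "pct X \<le>o |A|"
      using is_pct_pct[of X] unfolding is_pct_def by blast
    then show ?thesis using eq ordIso_symmetric ordLeq_ordIso_trans by blast
  qed
qed

end

theory Submission
  imports Defs
begin

text \<open>
  Write \<open>X\<close> for the space and call a compact set small if its character is at most \<open>\<kappa>\<close>. Were every
  point small, an elementary submodel of size \<open>\<kappa>\<close> would do: two open sets of the submodel that
  meet would meet inside it, so an uncountable disjoint family in the trace would reflect to one
  in \<open>X\<close>. Here only compact sets are small, and a small compact set \<open>L\<close> says nothing about open sets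
  that split \<open>L\<close>. The remedy is to pass to a closed set \<open>Z\<close> so thin that every open set
  meeting \<open>Z\<close> contains \<open>Z \<inter> L\<close> for some member \<open>L\<close> of a suitable family of small compact sets.

  Small compact sets are plentiful: a \<open>G\<^sub>\<delta>\<close> argument inside a small compact set, with \<open>\<kappa>\<close>
  neighbourhoods instead of countably many (\<open>small_compact_inside\<close>), puts a small
  compact set inside every nonempty open set, and also separates any \<open>\<kappa>\<close> points of \<open>X\<close>
  simultaneously by pairwise disjoint small compact sets (\<open>disjoint_small_compacts\<close>).
  Starting from \<open>\<kappa>\<close> such disjoint sets, a closing-off argument gives a family \<open>\<L>\<close> of \<open>\<kappa>\<close> nonempty
  small compact sets such that whenever two members of fixed outer bases of sets in \<open>\<L>\<close> meet, their
  intersection contains a set in \<open>\<L>\<close>.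

  Now let \<open>Z\<close> be a minimal closed set that meets every \<open>L \<in> \<L>\<close>; it exists by compactness
  and Zorn's lemma. If an open \<open>V\<close> meets \<open>Z\<close>, then by minimality \<open>Z - V\<close> misses some
  \<open>L \<in> \<L>\<close>; thus \<open>L \<subseteq> V \<union> (X - Z)\<close>, and a member \<open>U\<close> of the outer base of \<open>L\<close>
  satisfies \<open>U \<inter> Z \<subseteq> V\<close>. Let \<open>Y\<close> contain one point of \<open>Z \<inter> L\<close> for each \<open>L \<in> \<L>\<close>. It has
  \<open>\<kappa>\<close> points because \<open>\<L>\<close> contains \<open>\<kappa>\<close> disjoint sets, and by closure of \<open>\<L>\<close> outer base members that meet
  also meet in a point of \<open>Y\<close>. Hence replacing the members of a disjoint family of nonempty open subsets
  of \<open>Y\<close> by sets \<open>U\<close> as above gives a disjoint family in \<open>X\<close> (\<open>ccc_subtopologyI\<close>), which is countable.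
\<close>

section \<open>Closing off under a set-valued operation\<close>

lemma finite_ordLeq_Cinfinite:
  assumes "Cinfinite \<kappa>" "finite S"
  shows "|S| \<le>o \<kappa>"
proof -
  have "|S| \<le>o |Field \<kappa>|"
    using assms card_of_ordLeq_finite ordLeq_total[OF card_of_Well_order card_of_Well_order]
    unfolding cinfinite_def by blast
  then show ?thesis
    using assms(1) card_of_Field_ordIso ordLeq_ordIso_trans by blast
qed

lemma closing_off:
  fixes F :: "'b \<Rightarrow> 'b \<Rightarrow> 'b set" and \<kappa> :: "'k rel"
  assumes \<kappa>: "Cinfinite \<kappa>" and S0: "|S0| \<le>o \<kappa>" "S0 \<subseteq> D"
    and F: "\<And>a b. a \<in> D \<Longrightarrow> b \<in> D \<Longrightarrow> |F a b| \<le>o \<kappa> \<and> F a b \<subseteq> D"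
  obtains S where "S0 \<subseteq> S" "S \<subseteq> D" "|S| \<le>o \<kappa>" "\<And>a b. a \<in> S \<Longrightarrow> b \<in> S \<Longrightarrow> F a b \<subseteq> S"
proof -
  have inf: "\<not> finite (Field \<kappa>)" and co: "Card_order \<kappa>"
    using \<kappa> by (auto simp: cinfinite_def)
  define T where "T = rec_nat S0 (\<lambda>_ T. T \<union> (\<Union>(a, b)\<in>T \<times> T. F a b))"
  have T_0: "T 0 = S0" and T_Suc: "\<And>n. T (Suc n) = T n \<union> (\<Union>(a, b)\<in>T n \<times> T n. F a b)"
    by (simp_all add: T_def)
  have T: "|T n| \<le>o \<kappa> \<and> T n \<subseteq> D" for n
  proof (induction n)
    case 0
    then show ?case using S0 by (simp add: T_0)
  next
    case (Suc n)
    have "|T n \<times> T n| \<le>o \<kappa>"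
      using Suc inf co by (intro card_of_Times_ordLeq_infinite_Field) auto
    then have "|\<Union>(a, b)\<in>T n \<times> T n. F a b| \<le>o \<kappa>"
      using Suc inf co F by (intro card_of_UNION_ordLeq_infinite_Field) auto
    then have "|T (Suc n)| \<le>o \<kappa>"
      unfolding T_Suc using Suc inf co by (intro card_of_Un_ordLeq_infinite_Field) auto
    moreover have "T (Suc n) \<subseteq> D"
      unfolding T_Suc using Suc F by blast
    ultimately show ?case by blast
  qed
  have mono: "T m \<subseteq> T n" if "m \<le> n" for m n
    using that by (rule lift_Suc_mono_le[rotated]) (auto simp: T_Suc)
  have "|UNIV :: nat set| \<le>o \<kappa>"
    using inf co
    by (meson card_of_Field_ordIso infinite_iff_card_of_nat ordLeq_ordIso_trans)
  then have "|\<Union>n. T n| \<le>o \<kappa>"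
    using T inf co by (intro card_of_UNION_ordLeq_infinite_Field) auto
  moreover have "F a b \<subseteq> (\<Union>n. T n)" if a: "a \<in> (\<Union>n. T n)" and b: "b \<in> (\<Union>n. T n)" for a b
  proof -
    obtain m n where "a \<in> T m" "b \<in> T n" using a b by auto
    then have "a \<in> T (max m n)" "b \<in> T (max m n)"
      using mono[of m "max m n"] mono[of n "max m n"] by auto
    then have "F a b \<subseteq> T (Suc (max m n))" by (auto simp: T_Suc)
    then show ?thesis by blast
  qed
  ultimately show ?thesis
    using that[of "\<Union>n. T n"] T T_0 by blast
qed

section \<open>Small compact sets\<close>

definition small_compact :: "'a topology \<Rightarrow> 'k rel \<Rightarrow> 'a set \<Rightarrow> bool" where
  "small_compact X \<kappa> K \<longleftrightarrow> compactin X K \<and> character K X \<le>o \<kappa>"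

lemma compactin_subset_directed_Union:
  assumes K: "compactin X K" and op: "\<And>V. V \<in> \<V> \<Longrightarrow> openin X V" and ne: "\<V> \<noteq> {}"
    and dir: "\<And>V V'. V \<in> \<V> \<Longrightarrow> V' \<in> \<V> \<Longrightarrow> \<exists>V''\<in>\<V>. V \<union> V' \<subseteq> V''"
    and cov: "K \<subseteq> \<Union>\<V>"
  obtains V where "V \<in> \<V>" "K \<subseteq> V"
proof -
  obtain \<F> where \<F>: "finite \<F>" "\<F> \<subseteq> \<V>" "K \<subseteq> \<Union>\<F>"
    using K op cov unfolding compactin_def by meson
  have "\<exists>V\<in>\<V>. \<Union>\<F> \<subseteq> V"
    using \<F>(1,2)
  proof (induction \<F>)
    case empty
    then show ?case using ne by auto
  next
    case (insert A \<F>)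
    then obtain V where V: "V \<in> \<V>" "\<Union>\<F> \<subseteq> V" by auto
    moreover obtain V'' where "V'' \<in> \<V>" "A \<union> V \<subseteq> V''"
      using dir[of A V] insert.prems V(1) by auto
    ultimately show ?case by (intro bexI[of _ V'']) auto
  qed
  then obtain V where V: "V \<in> \<V>" "\<Union>\<F> \<subseteq> V" by (elim bexE)
  show ?thesis by (rule that[OF V(1) order_trans[OF \<F>(3) V(2)]])
qed

text \<open>
  This generalizes the fact that a compact \<open>G\<^sub>\<delta>\<close> subset of a compact set of countable character has countable
  character. Enlarge the given neighbourhoods to a family \<open>\<W>\<close> that is closed under intersection and
  contains with \<open>W\<close> a neighbourhood whose closure meets \<open>K\<close> within \<open>W\<close>. Then \<open>L = K \<inter> \<Inter>\<W>\<close> is also the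
  intersection of \<open>K\<close> with the closures of the members of \<open>\<W>\<close>, so it is compact, and
  compactness of \<open>K\<close> makes the sets \<open>B \<inter> W\<close>, with \<open>B\<close> from an outer base of \<open>K\<close>, an outer base of \<open>L\<close>.
\<close>

lemma small_compact_inside:
  fixes X :: "'a topology" and \<kappa> :: "'k rel"
  assumes X: "Hausdorff_space X" and \<kappa>: "Cinfinite \<kappa>" and K: "small_compact X \<kappa> K" and x: "x \<in> K"
    and \<N>: "|\<N>| \<le>o \<kappa>" "\<And>N. N \<in> \<N> \<Longrightarrow> openin X N \<and> x \<in> N"
  obtains L where "small_compact X \<kappa> L" "x \<in> L" "\<And>N. N \<in> \<N> \<Longrightarrow> L \<subseteq> N"
proof -
  have inf: "\<not> finite (Field \<kappa>)" and co: "Card_order \<kappa>"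
    using \<kappa> by (auto simp: cinfinite_def)
  have Kc: "compactin X K" and KX: "K \<subseteq> topspace X"
    using K compactin_subset_topspace by (auto simp: small_compact_def)
  define D where "D = {W. openin X W \<and> x \<in> W}"
  have "\<exists>W'. W' \<in> D \<and> K \<inter> (X closure_of W') \<subseteq> W" if "W \<in> D" for W
  proof -
    have "compactin X (K - W)"
    proof -
      have "K - W = (topspace X - W) \<inter> K" using KX by blast
      moreover have "closedin X (topspace X - W)" using that by (auto simp: D_def)
      ultimately show ?thesis using Kc by (simp add: closed_Int_compactin)
    qed
    moreover have "compactin X {x}" "disjnt {x} (K - W)"
      using x KX that by (auto simp: D_def)
    ultimately obtain U V where "openin X U" "openin X V" "{x} \<subseteq> U" "K - W \<subseteq> V" "disjnt U V"
      using Hausdorff_space_compact_separation[OF X] by metis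
    moreover have "V \<inter> X closure_of U = {}"
      using calculation by (simp add: disjnt_def openin_Int_closure_of_eq_empty Int_commute)
    ultimately show ?thesis by (intro exI[of _ U]) (auto simp: D_def)
  qed
  then obtain r where r: "\<And>W. W \<in> D \<Longrightarrow> r W \<in> D \<and> K \<inter> (X closure_of (r W)) \<subseteq> W"
    by metis
  have "|{topspace X} \<union> \<N>| \<le>o \<kappa>"
    by (intro card_of_Un_ordLeq_infinite_Field[OF inf _ \<N>(1) co] finite_ordLeq_Cinfinite[OF \<kappa>]) simp
  moreover have "{topspace X} \<union> \<N> \<subseteq> D"
    using \<N>(2) x KX by (auto simp: D_def)
  ultimately obtain \<W> where \<W>: "{topspace X} \<union> \<N> \<subseteq> \<W>" "\<W> \<subseteq> D" "|\<W>| \<le>o \<kappa>"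
    and clos: "\<And>A B. A \<in> \<W> \<Longrightarrow> B \<in> \<W> \<Longrightarrow> {A \<inter> B, r A} \<subseteq> \<W>"
  proof (rule closing_off[OF \<kappa>, where F = "\<lambda>A B. {A \<inter> B, r A}"])
    show "|{A \<inter> B, r A}| \<le>o \<kappa> \<and> {A \<inter> B, r A} \<subseteq> D" if "A \<in> D" "B \<in> D" for A B
      using that r finite_ordLeq_Cinfinite[OF \<kappa>, of "{A \<inter> B, r A}"] by (auto simp: D_def)
  qed (rule that)
  have \<W>_open: "openin X W" "x \<in> W" and closure: "W \<subseteq> X closure_of W"
    and \<W>_r: "r W \<in> \<W>" "K \<inter> X closure_of (r W) \<subseteq> W" if "W \<in> \<W>" for W
  proof -
    have W: "W \<in> D" using \<W>(2) that by blast
    then show "openin X W" "x \<in> W" by (auto simp: D_def)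
    then show "W \<subseteq> X closure_of W" by (simp add: closure_of_subset openin_subset)
    show "r W \<in> \<W>" using clos[OF that that] by simp
    show "K \<inter> X closure_of (r W) \<subseteq> W" using r[OF W] by simp
  qed
  define L where "L = K \<inter> \<Inter>\<W>"
  have L_closures: "L = K \<inter> (\<Inter>W\<in>\<W>. X closure_of W)"
  proof
    show "L \<subseteq> K \<inter> (\<Inter>W\<in>\<W>. X closure_of W)"
      unfolding L_def using closure by blast
    show "K \<inter> (\<Inter>W\<in>\<W>. X closure_of W) \<subseteq> L"
      unfolding L_def using \<W>_r by blast
  qed
  have "closedin X (\<Inter>W\<in>\<W>. X closure_of W)"
    using \<W>(1) by (intro closedin_INT) auto
  then have "compactin X L"
    unfolding L_closures using Kc by (metis closed_Int_compactin Int_commute)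
  moreover have "character L X \<le>o \<kappa>"
  proof -
    obtain \<B> where \<B>: "outer_base K X \<B>" "|\<B>| \<le>o \<kappa>"
      using character_attained[of K X] K unfolding small_compact_def by metis
    let ?\<B>' = "(\<lambda>(B, W). B \<inter> W) ` (\<B> \<times> \<W>)"
    have "outer_base L X ?\<B>'"
      unfolding outer_base_def
    proof (intro conjI allI impI)
      show "\<forall>C\<in>?\<B>'. openin X C \<and> L \<subseteq> C"
        using \<B>(1) \<W>_open(1) unfolding outer_base_def L_def by (auto simp: openin_Int)
    next
      fix G assume G: "openin X G \<and> L \<subseteq> G"
      let ?V = "\<lambda>W. G \<union> (topspace X - X closure_of W)"
      obtain W where W: "W \<in> \<W>" "K \<subseteq> ?V W"
      proof (rule compactin_subset_directed_Union[OF Kc, of "?V ` \<W>"])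
        show "openin X V" if "V \<in> ?V ` \<W>" for V
          using that G by (auto intro!: openin_Un openin_diff)
        show "?V ` \<W> \<noteq> {}" using \<W>(1) by auto
        show "\<exists>V''\<in>?V ` \<W>. V \<union> V' \<subseteq> V''" if VV': "V \<in> ?V ` \<W>" "V' \<in> ?V ` \<W>" for V V'
        proof -
          obtain W W' where "W \<in> \<W>" "W' \<in> \<W>" "V = ?V W" "V' = ?V W'"
            using VV' by auto
          moreover have "X closure_of (W \<inter> W') \<subseteq> X closure_of W \<inter> X closure_of W'"
            by (simp add: closure_of_mono)
          ultimately show ?thesis
            using clos[of W W'] by (intro bexI[of _ "?V (W \<inter> W')"]) auto
        qed
        show "K \<subseteq> \<Union>(?V ` \<W>)"
        proof
          fix k assume k: "k \<in> K"
          show "k \<in> \<Union>(?V ` \<W>)"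
          proof (cases "k \<in> L")
            case True
            then show ?thesis using G \<W>(1) by auto
          next
            case False
            then obtain W where "W \<in> \<W>" "k \<notin> X closure_of W"
              using k unfolding L_closures by auto
            then show ?thesis using k KX by auto
          qed
        qed
      qed (use that in auto)
      have "openin X (?V W)"
        using G by (auto intro!: openin_Un openin_diff)
      then obtain B where B: "B \<in> \<B>" "B \<subseteq> ?V W"
        using \<B>(1) W(2) unfolding outer_base_def by meson
      have "W \<subseteq> X closure_of W"
        using W(1) by (rule closure)
      then have "B \<inter> W \<subseteq> G" using B by auto
      then show "\<exists>C\<in>?\<B>'. C \<subseteq> G" using B W by auto
    qed
    then have "character L X \<le>o |?\<B>'|" by (rule character_least)
    also have "|?\<B>'| \<le>o |\<B> \<times> \<W>|" by (rule card_of_image)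
    also have "|\<B> \<times> \<W>| \<le>o \<kappa>"
      using inf co \<B>(2) \<W>(3) by (intro card_of_Times_ordLeq_infinite_Field) auto
    finally show ?thesis .
  qed
  moreover have "x \<in> L" using x \<W>_open(2) by (auto simp: L_def)
  moreover have "L \<subseteq> N" if "N \<in> \<N>" for N using that \<W>(1) by (auto simp: L_def)
  ultimately show ?thesis using that[of L] by (simp add: small_compact_def)
qed

text \<open>
  In a Hausdorff space distinct points \<open>x\<close>, \<open>y\<close> have disjoint neighbourhoods \<open>N x y\<close>, \<open>N y x\<close>; squeeze the
  set around \<open>x\<close> into all \<open>N x y\<close> at once, which are at most \<open>\<kappa>\<close> many.
\<close>

lemma disjoint_small_compacts:
  fixes X :: "'a topology" and \<kappa> :: "'k rel"
  assumes X: "Hausdorff_space X" and \<kappa>: "Cinfinite \<kappa>"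
    and cov: "\<And>x. x \<in> topspace X \<Longrightarrow> \<exists>K. small_compact X \<kappa> K \<and> x \<in> K"
    and A: "A \<subseteq> topspace X" "|A| \<le>o \<kappa>"
  obtains L where "\<And>x. x \<in> A \<Longrightarrow> small_compact X \<kappa> (L x) \<and> x \<in> L x"
    and "\<And>x y. x \<in> A \<Longrightarrow> y \<in> A \<Longrightarrow> x \<noteq> y \<Longrightarrow> L x \<inter> L y = {}"
proof -
  have "\<exists>U V. openin X U \<and> openin X V \<and> x \<in> U \<and> y \<in> V \<and> disjnt U V"
    if "x \<in> A" "y \<in> A" "x \<noteq> y" for x y
    using X A(1) that unfolding Hausdorff_space_def by (meson subsetD)
  then obtain U V where UV: "\<And>x y. x \<in> A \<Longrightarrow> y \<in> A \<Longrightarrow> x \<noteq> y \<Longrightarrow>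
      openin X (U x y) \<and> openin X (V x y) \<and> x \<in> U x y \<and> y \<in> V x y \<and> disjnt (U x y) (V x y)"
    by metis
  define N where "N x y = U x y \<inter> V y x" for x y
  have "\<exists>L. small_compact X \<kappa> L \<and> x \<in> L \<and> (\<forall>y\<in>A - {x}. L \<subseteq> N x y)" if x: "x \<in> A" for x
  proof -
    obtain K where K: "small_compact X \<kappa> K" "x \<in> K" using cov x A(1) by blast
    have "|N x ` (A - {x})| \<le>o |A - {x}|" by (rule card_of_image)
    also have "|A - {x}| \<le>o |A|" by (rule card_of_mono1) auto
    also note A(2)
    finally have "|N x ` (A - {x})| \<le>o \<kappa>" .
    moreover have "openin X M \<and> x \<in> M" if "M \<in> N x ` (A - {x})" for M
      using that x UV unfolding N_def by fastforce
    ultimately show ?thesis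
      by (rule small_compact_inside[OF X \<kappa> K]) auto
  qed
  then obtain L where L: "\<And>x. x \<in> A \<Longrightarrow>
      small_compact X \<kappa> (L x) \<and> x \<in> L x \<and> (\<forall>y\<in>A - {x}. L x \<subseteq> N x y)"
    by metis
  have "L x \<inter> L y = {}" if xy: "x \<in> A" "y \<in> A" "x \<noteq> y" for x y
  proof -
    have "L x \<subseteq> U x y" "L y \<subseteq> V x y" using L xy unfolding N_def by blast+
    then show ?thesis using UV[OF xy] unfolding disjnt_def by blast
  qed
  then show ?thesis using that[of L] L by blast
qed

text \<open>
  Complements of closed sets \<open>Z\<close> that meet every \<open>L \<in> \<L>\<close> are the open sets \<open>O\<close> including no \<open>L \<in> \<L>\<close>. Phrased
  this way, compactness of the sets \<open>L\<close> shows that these \<open>O\<close> are closed under unions of chains.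
\<close>

lemma maximal_open_including_no_compact:
  assumes \<L>: "\<And>L. L \<in> \<L> \<Longrightarrow> compactin X L \<and> L \<noteq> {}"
  obtains M where "openin X M" "\<And>L. L \<in> \<L> \<Longrightarrow> \<not> L \<subseteq> M"
    and "\<And>V. openin X V \<Longrightarrow> \<not> V \<subseteq> M \<Longrightarrow> \<exists>L\<in>\<L>. L \<subseteq> V \<union> M"
proof -
  let ?\<A> = "{M. openin X M \<and> (\<forall>L\<in>\<L>. \<not> L \<subseteq> M)}"
  have "\<exists>M\<in>?\<A>. \<forall>M'\<in>?\<A>. M \<subseteq> M' \<longrightarrow> M' = M"
  proof (rule subset_Zorn_nonempty)
    show "?\<A> \<noteq> {}" using \<L> by (auto intro!: exI[of _ "{}"])
  next
    fix \<C> assume ne: "\<C> \<noteq> {}" and ch: "subset.chain ?\<A> \<C>"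
    have sub: "\<C> \<subseteq> ?\<A>" and lin: "\<And>C C'. C \<in> \<C> \<Longrightarrow> C' \<in> \<C> \<Longrightarrow> C \<subseteq> C' \<or> C' \<subseteq> C"
      using ch by (auto simp: subset_chain_def)
    have "\<not> L \<subseteq> \<Union>\<C>" if L: "L \<in> \<L>" for L
    proof
      assume cov: "L \<subseteq> \<Union>\<C>"
      have "compactin X L" using \<L> L by blast
      then obtain C where "C \<in> \<C>" "L \<subseteq> C"
      proof (rule compactin_subset_directed_Union)
        show "\<exists>V''\<in>\<C>. V \<union> V' \<subseteq> V''" if "V \<in> \<C>" "V' \<in> \<C>" for V V'
          using lin[OF that] that by (metis Un_absorb1 Un_absorb2 order_refl)
      qed (use sub ne cov in auto)
      then show False using sub L by blast
    qed
    then show "\<Union>\<C> \<in> ?\<A>" using sub by auto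
  qed
  then obtain M where M: "M \<in> ?\<A>" and max: "\<And>M'. M' \<in> ?\<A> \<Longrightarrow> M \<subseteq> M' \<Longrightarrow> M' = M"
    by auto
  have "\<exists>L\<in>\<L>. L \<subseteq> V \<union> M" if "openin X V" "\<not> V \<subseteq> M" for V
    using max[of "V \<union> M"] M that by auto
  then show ?thesis using that[of M] M by blast
qed

section \<open>Subspaces satisfying the countable chain condition\<close>

text \<open>
  The sets \<open>\<U>\<close> serve as a \<open>\<pi>\<close>-base of \<open>Y\<close> on which disjointness of traces reflects to disjointness in the whole
  space, so a disjoint family in \<open>Y\<close> refines to one of the same size in \<open>X\<close>.
\<close>

lemma ccc_subtopologyI:
  assumes X: "ccc_space X" and \<U>: "\<And>U. U \<in> \<U> \<Longrightarrow> openin X U"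
    and base: "\<And>V. openin X V \<Longrightarrow> V \<inter> Y \<noteq> {} \<Longrightarrow> \<exists>U\<in>\<U>. U \<noteq> {} \<and> U \<inter> Y \<subseteq> V"
    and reflect: "\<And>U U'. U \<in> \<U> \<Longrightarrow> U' \<in> \<U> \<Longrightarrow> U \<inter> U' \<noteq> {} \<Longrightarrow> U \<inter> U' \<inter> Y \<noteq> {}"
  shows "ccc_space (subtopology X Y)"
  unfolding ccc_space_def
proof (intro allI impI)
  fix \<G> assume \<G>: "(\<forall>G\<in>\<G>. openin (subtopology X Y) G) \<and> uncountable \<G>"
  show "\<exists>G\<in>\<G>. \<exists>G'\<in>\<G>. G \<noteq> G' \<and> G \<inter> G' \<noteq> {}"
  proof (rule ccontr)
    assume "\<not> ?thesis"
    then have disj: "\<And>G G'. G \<in> \<G> \<Longrightarrow> G' \<in> \<G> \<Longrightarrow> G \<noteq> G' \<Longrightarrow> G \<inter> G' = {}"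
      by metis
    have "\<exists>U. U \<in> \<U> \<and> U \<noteq> {} \<and> U \<inter> Y \<subseteq> G" if G: "G \<in> \<G> - {{}}" for G
    proof -
      have "openin (subtopology X Y) G" using \<G> G by blast
      then obtain V where "openin X V" "G = V \<inter> Y"
        unfolding openin_subtopology by blast
      then show ?thesis using base[of V] G by auto
    qed
    then obtain u where u: "\<And>G. G \<in> \<G> - {{}} \<Longrightarrow> u G \<in> \<U> \<and> u G \<noteq> {} \<and> u G \<inter> Y \<subseteq> G"
      by metis
    have disj_u: "u G \<inter> u G' = {}" if "G \<in> \<G> - {{}}" "G' \<in> \<G> - {{}}" "G \<noteq> G'" for G G'
    proof (rule ccontr)
      assume "u G \<inter> u G' \<noteq> {}"
      then have "u G \<inter> u G' \<inter> Y \<noteq> {}" using reflect u that by blast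
      then show False using u[of G] u[of G'] disj[of G G'] that by blast
    qed
    have "inj_on u (\<G> - {{}})"
    proof (rule inj_onI, rule ccontr)
      fix G G' assume G: "G \<in> \<G> - {{}}" "G' \<in> \<G> - {{}}" "u G = u G'" "G \<noteq> G'"
      then show False using disj_u[of G G'] u[of G] by auto
    qed
    then have "uncountable (u ` (\<G> - {{}}))"
      using \<G> by (metis countable_image_inj_eq uncountable_minus_countable countable_empty countable_insert)
    moreover have "\<forall>U\<in>u ` (\<G> - {{}}). openin X U" using u \<U> by blast
    ultimately obtain U U' where "U \<in> u ` (\<G> - {{}})" "U' \<in> u ` (\<G> - {{}})" "U \<noteq> U'" "U \<inter> U' \<noteq> {}"
      using X unfolding ccc_space_def by meson
    then show False using disj_u by auto
  qed
qed

section \<open>Dense subsets of a minimal closed transversal\<close>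

theorem theorem7:
  fixes X :: "'a topology" and \<kappa> :: "'k rel"
  assumes "Hausdorff_space X"
    and "ccc_space X"
    and "Card_order \<kappa>"
    and "pct X \<le>o \<kappa>"
    and "\<kappa> \<le>o |topspace X|"
  shows "\<exists>Y. Y \<subseteq> topspace X \<and> |Y| =o \<kappa> \<and> ccc_space (subtopology X Y)"
proof -
  have \<kappa>: "Cinfinite \<kappa>"
    using assms(3,4) pct_Cinfinite[of X] by (blast intro: cinfinite_mono)
  then have inf: "\<not> finite (Field \<kappa>)" by (auto simp: cinfinite_def)
  have cov: "\<exists>K. small_compact X \<kappa> K \<and> x \<in> K" if "x \<in> topspace X" for x
    using covered_by_compacts_mono[OF pct_covered assms(4)] that
    unfolding covered_by_compacts_of_character_le_def small_compact_def by blast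
  have "|Field \<kappa>| \<le>o |topspace X|"
    using card_of_Field_ordIso[OF assms(3)] assms(5) ordIso_ordLeq_trans by blast
  then obtain f where f: "inj_on f (Field \<kappa>)" "f ` Field \<kappa> \<subseteq> topspace X"
    by (auto simp flip: card_of_ordLeq)
  define A where "A = f ` Field \<kappa>"
  have A: "A \<subseteq> topspace X" using f(2) by (simp add: A_def)
  have "|A| =o |Field \<kappa>|"
    using f(1) card_of_ordIso inj_on_imp_bij_betw ordIso_symmetric unfolding A_def by blast
  then have A_card: "|A| =o \<kappa>"
    using card_of_Field_ordIso[OF assms(3)] ordIso_transitive by blast
  obtain l where l: "\<And>x. x \<in> A \<Longrightarrow> small_compact X \<kappa> (l x) \<and> x \<in> l x"
    and l_disj: "\<And>x y. x \<in> A \<Longrightarrow> y \<in> A \<Longrightarrow> x \<noteq> y \<Longrightarrow> l x \<inter> l y = {}"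
    using disjoint_small_compacts[OF assms(1) \<kappa> cov A ordIso_imp_ordLeq[OF A_card]] by blast

  \<comment> \<open>\<open>s\<close> picks a small compact set inside an open set and \<open>b\<close> an outer base; \<open>F\<close> then demands a member of the
    family inside each nonempty intersection of outer base members.\<close>
  define D where "D = {L. small_compact X \<kappa> L \<and> L \<noteq> {}}"
  have "\<exists>L\<in>D. L \<subseteq> W" if W: "openin X W" "W \<noteq> {}" for W
  proof -
    obtain x where x: "x \<in> W" using W by auto
    moreover have "x \<in> topspace X" using x W openin_subset by blast
    ultimately obtain K where K: "small_compact X \<kappa> K" "x \<in> K" using cov by blast
    have "|{W}| \<le>o \<kappa>"
      by (simp add: finite_ordLeq_Cinfinite[OF \<kappa>])
    then obtain L where "small_compact X \<kappa> L" "x \<in> L" "L \<subseteq> W"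
      by (rule small_compact_inside[OF assms(1) \<kappa> K]) (use x W in auto)
    then show ?thesis by (auto simp: D_def)
  qed
  then obtain s where s: "\<And>W. openin X W \<Longrightarrow> W \<noteq> {} \<Longrightarrow> s W \<in> D \<and> s W \<subseteq> W"
    by metis
  have "\<exists>\<B>. outer_base L X \<B> \<and> |\<B>| \<le>o \<kappa>" if "L \<in> D" for L
  proof -
    obtain \<B> where "outer_base L X \<B>" "character L X = |\<B>|" by (rule character_attained)
    then show ?thesis using that by (auto simp: D_def small_compact_def)
  qed
  then obtain b where b: "\<And>L. L \<in> D \<Longrightarrow> outer_base L X (b L) \<and> |b L| \<le>o \<kappa>"
    by metis
  have b_open: "openin X U \<and> L \<subseteq> U \<and> U \<noteq> {}" if "L \<in> D" "U \<in> b L" for L U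
    using b[OF that(1)] that unfolding outer_base_def D_def by fastforce
  define F where "F L L' = s ` ((\<lambda>(U, U'). U \<inter> U') ` (b L \<times> b L') - {{}})" for L L'
  have F: "|F L L'| \<le>o \<kappa> \<and> F L L' \<subseteq> D" if L: "L \<in> D" "L' \<in> D" for L L'
  proof
    let ?I = "(\<lambda>(U, U'). U \<inter> U') ` (b L \<times> b L')"
    have "|F L L'| \<le>o |?I - {{}}|"
      unfolding F_def by (rule card_of_image)
    also have "|?I - {{}}| \<le>o |?I|"
      by (rule card_of_mono1) auto
    also have "|?I| \<le>o |b L \<times> b L'|" by (rule card_of_image)
    also have "|b L \<times> b L'| \<le>o \<kappa>"
      using b L inf assms(3) by (intro card_of_Times_ordLeq_infinite_Field) auto
    finally show "|F L L'| \<le>o \<kappa>" .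
    show "F L L' \<subseteq> D"
    proof
      fix L'' assume "L'' \<in> F L L'"
      then obtain U U' where U: "U \<in> b L" "U' \<in> b L'" "U \<inter> U' \<noteq> {}" "L'' = s (U \<inter> U')"
        by (auto simp: F_def)
      then have "openin X (U \<inter> U')" using b_open L by blast
      then show "L'' \<in> D" using s U by blast
    qed
  qed
  have "|l ` A| \<le>o \<kappa>"
    using card_of_image A_card ordLeq_ordIso_trans by blast
  moreover have "l ` A \<subseteq> D" using l by (auto simp: D_def)
  ultimately obtain \<L> where \<L>: "l ` A \<subseteq> \<L>" "\<L> \<subseteq> D" "|\<L>| \<le>o \<kappa>"
    and clos: "\<And>L L'. L \<in> \<L> \<Longrightarrow> L' \<in> \<L> \<Longrightarrow> F L L' \<subseteq> \<L>"
  proof (rule closing_off[OF \<kappa>, where F = F])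
    show "|F L L'| \<le>o \<kappa> \<and> F L L' \<subseteq> D" if "L \<in> D" "L' \<in> D" for L L'
      using that by (rule F)
  qed (rule that)

  \<comment> \<open>The complement of \<open>M\<close> is a minimal closed set \<open>Z\<close> that meets every member of \<open>\<L>\<close>.\<close>
  obtain M where M: "openin X M" "\<And>L. L \<in> \<L> \<Longrightarrow> \<not> L \<subseteq> M"
    and M_max: "\<And>V. openin X V \<Longrightarrow> \<not> V \<subseteq> M \<Longrightarrow> \<exists>L\<in>\<L>. L \<subseteq> V \<union> M"
  proof (rule maximal_open_including_no_compact)
    show "compactin X L \<and> L \<noteq> {}" if "L \<in> \<L>" for L
      using that \<L>(2) by (auto simp: D_def small_compact_def)
  qed (rule that)
  have "\<exists>y. y \<in> L - M" if "L \<in> \<L>" for L using M(2)[OF that] by blast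
  then obtain y where y: "\<And>L. L \<in> \<L> \<Longrightarrow> y L \<in> L - M" by metis
  define Y where "Y = y ` \<L>"

  have "Y \<subseteq> topspace X"
    using y \<L>(2) compactin_subset_topspace unfolding Y_def D_def small_compact_def by blast
  moreover have "|Y| =o \<kappa>"
  proof -
    \<comment> \<open>The lower bound comes from the disjoint sets \<open>l x\<close> put into \<open>\<L>\<close> at the start.\<close>
    have "|Y| \<le>o |\<L>|" unfolding Y_def by (rule card_of_image)
    then have "|Y| \<le>o \<kappa>" using \<L>(3) ordLeq_transitive by blast
    moreover have "inj_on (\<lambda>x. y (l x)) A"
      using y \<L>(1) l_disj by (intro inj_onI) (metis DiffD1 IntI empty_iff image_subset_iff)
    then have "|A| \<le>o |Y|"
      using \<L>(1) by (intro card_of_ordLeqI[of "\<lambda>x. y (l x)"]) (auto simp: Y_def)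
    then have "\<kappa> \<le>o |Y|"
      using A_card ordIso_symmetric ordIso_ordLeq_trans by blast
    ultimately show ?thesis by (simp add: ordIso_iff_ordLeq)
  qed
  moreover have "ccc_space (subtopology X Y)"
  proof (rule ccc_subtopologyI[OF assms(2), where \<U> = "\<Union>(b ` \<L>)"])
    show "openin X U" if "U \<in> \<Union>(b ` \<L>)" for U
      using that b_open \<L>(2) by blast
  next
    fix V assume V: "openin X V" "V \<inter> Y \<noteq> {}"
    then have "\<not> V \<subseteq> M" using y by (auto simp: Y_def)
    then obtain L where L: "L \<in> \<L>" "L \<subseteq> V \<union> M" using M_max V(1) by blast
    moreover have "openin X (V \<union> M)" using V(1) M(1) by blast
    ultimately obtain U where U: "U \<in> b L" "U \<subseteq> V \<union> M"
      using b \<L>(2) unfolding outer_base_def by (meson subsetD)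
    have "L \<in> D" using L(1) \<L>(2) by blast
    then have "U \<noteq> {}" using b_open U(1) by blast
    moreover have "U \<inter> Y \<subseteq> V" using U(2) y by (auto simp: Y_def)
    moreover have "U \<in> \<Union>(b ` \<L>)" using U(1) L(1) by blast
    ultimately show "\<exists>U\<in>\<Union>(b ` \<L>). U \<noteq> {} \<and> U \<inter> Y \<subseteq> V" by blast
  next
    fix U U' assume "U \<in> \<Union>(b ` \<L>)" "U' \<in> \<Union>(b ` \<L>)" and ne: "U \<inter> U' \<noteq> {}"
    then obtain L L' where L: "L \<in> \<L>" "L' \<in> \<L>" "U \<in> b L" "U' \<in> b L'" by blast
    have "s (U \<inter> U') \<in> F L L'" using L ne unfolding F_def by blast
    then have "s (U \<inter> U') \<in> \<L>" using clos L by blast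
    moreover have "L \<in> D" "L' \<in> D" using L(1,2) \<L>(2) by auto
    then have "openin X (U \<inter> U')" using b_open L(3,4) by blast
    then have "s (U \<inter> U') \<subseteq> U \<inter> U'" using s ne by blast
    ultimately have "y (s (U \<inter> U')) \<in> U \<inter> U' \<inter> Y" using y unfolding Y_def by blast
    then show "U \<inter> U' \<inter> Y \<noteq> {}" by blast
  qed
  ultimately show ?thesis by blast
qed

end
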